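(* Let $\gamma=(\gamma_1,\dots,\gamma_d)\vdash n$ and $1\le m\le n$. Then $$\mu_{n,m}(\gamma)=|\mathcal{C}_\gamma|\sum_{k=0}^{n-m}\frac{(-1)^k{m+k\brack m}}{(m+k)!}\sum_{\substack{k_1+\cdots+k_d=n-m-k+1\\ k_1>0,\dots,k_d>0}}\prod_{i=1}^d\binom{\gamma_i}{k_i}.$$
   Context: Fix $\omega=(1\,2\,\cdots\,n)$. For a partition $\gamma\vdash n$ and integer $m\ge1$, $\mu_{n,m}(\gamma)$ is the number of pairs $(\sigma,\pi)$ of permutations of $[n]$ with $\sigma\pi=\omega$ (product right to left), $\sigma$ of cycle type $\gamma$, and $\pi$ having exactly $m$ cycles (equivalently, the number of $\sigma$ of cycle type $\gamma$ such that $\sigma^{-1}\omega$ has $m$ cycles). $\mathcal{C}_\gamma$ is the conjugacy class of permutations of cycle type $\gamma$, so $|\mathcal{C}_\gamma|=n!/z_\gamma$ with $z_\gamma=\prod_i i^{a_i}a_i!$ when $\gamma=[1^{a_1},\dots,n^{a_n}]$. ${n\brack k}$ denotes the unsigned Stirling number of the first kind (number of permutations of $[n]$ with $k$ cycles). *)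

theory Defs
  imports Complex_Main "HOL-Combinatorics.Permutations" "HOL-Combinatorics.Orbits"
    "HOL-Combinatorics.Stirling" "HOL-Library.Multiset"
begin

definition long_cycle :: "nat \<Rightarrow> nat \<Rightarrow> nat" where
  "long_cycle n i = (if 1 \<le> i \<and> i < n then i + 1 else if i = n then 1 else i)"

text \<open>The cycles of a permutation of [n] are its orbits (fixed points give 1-cycles).\<close>
definition perm_cycles :: "nat \<Rightarrow> (nat \<Rightarrow> nat) \<Rightarrow> nat set set" where
  "perm_cycles n p = (\<lambda>x. orbit p x) ` {1..n}"

definition num_cycles :: "nat \<Rightarrow> (nat \<Rightarrow> nat) \<Rightarrow> nat" where
  "num_cycles n p = card (perm_cycles n p)"

definition cycle_type :: "nat \<Rightarrow> (nat \<Rightarrow> nat) \<Rightarrow> nat multiset" where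
  "cycle_type n p = image_mset card (mset_set (perm_cycles n p))"

definition is_partition :: "nat list \<Rightarrow> nat \<Rightarrow> bool" where
  "is_partition \<gamma> n \<longleftrightarrow> sorted_wrt (\<ge>) \<gamma> \<and> (\<forall>x\<in>set \<gamma>. 0 < x) \<and> sum_list \<gamma> = n"

definition conj_class :: "nat \<Rightarrow> nat list \<Rightarrow> (nat \<Rightarrow> nat) set" where
  "conj_class n \<gamma> = {\<sigma>. \<sigma> permutes {1..n} \<and> cycle_type n \<sigma> = mset \<gamma>}"

definition mu :: "nat \<Rightarrow> nat \<Rightarrow> nat list \<Rightarrow> nat" where
  "mu n m \<gamma> = card {(\<sigma>, \<pi>). \<sigma> permutes {1..n} \<and> \<pi> permutes {1..n} \<and>
       \<sigma> \<circ> \<pi> = long_cycle n \<and> cycle_type n \<sigma> = mset \<gamma> \<and> num_cycles n \<pi> = m}"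

definition compositions :: "nat \<Rightarrow> nat \<Rightarrow> nat list set" where
  "compositions d N = {ks. length ks = d \<and> (\<forall>x\<in>set ks. 0 < x) \<and> sum_list ks = N}"

end

theory Submission
  imports Defs "HOL-Computational_Algebra.Polynomial"
begin

text \<open>
  For a fixed permutation \<open>s\<close> of an \<open>n\<close>-set, let \<open>F\<^sub>s(x)\<close> be the sum of \<open>x\<close> to the number of
  cycles of \<open>s\<inverse> w\<close> over all \<open>n\<close>-cycles \<open>w\<close>. Deleting a point \<open>e\<close> from its place after \<open>a\<close> in \<open>w\<close>,
  and from its place after \<open>y\<close> in \<open>s\<close> (leaving \<open>s'\<close>), gives
  \<open>F\<^sub>s = x F\<^sub>s\<^sub>' + (\<Sum>a \<noteq> y. F(s' (a y)))\<close>, where the term \<open>a = y\<close> contributes \<open>x F\<^sub>s\<^sub>'\<close>.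
  The transposition \<open>(a y)\<close> splits the cycle of \<open>y\<close> or joins it to the cycle of \<open>a\<close>, so that
  \<open>F\<^sub>s(x) = (n - 1)! (\<Sum>k. [z\<^sup>k] P\<^sub>s(z) \<cdot> (x gchoose (n + 1 - k)))\<close> with
  \<open>P\<^sub>s(z) = (\<Prod>C. (1 + z)\<^bsup>|C|\<^esup> - 1)\<close>, the product over the cycles of \<open>s\<close>, follows by induction
  on \<open>n\<close> from a polynomial identity. Since all \<open>n\<close>-cycles are conjugate and \<open>F\<^sub>s\<close> depends only on the
  cycle type, double counting the pairs \<open>(s, w)\<close> passes from a fixed \<open>s\<close> to the fixed long cycle;
  expanding \<open>x gchoose N\<close> in Stirling numbers and \<open>P\<^sub>s\<close> in compositions finishes the proof.
\<close>

section \<open>Cycles under multiplication by a transposition\<close>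

lemma orbit_period:
  assumes "finite V" "p permutes V"
  shows "0 < card (orbit p x)" and "(p ^^ card (orbit p x)) x = x"
    and "inj_on (\<lambda>j. (p ^^ j) x) {0..<card (orbit p x)}"
    and "orbit p x = (\<lambda>j. (p ^^ j) x) ` {0..<card (orbit p x)}"
proof -
  have self: "x \<in> orbit p x"
    using assms permutation_permutes permutation_self_in_orbit by metis
  note eq = orbit_conv_funpow_dist1[OF self] and inj = inj_on_funpow_dist1[OF self]
  have card: "card (orbit p x) = funpow_dist1 p x x"
    unfolding eq card_image[OF inj] by simp
  show "0 < card (orbit p x)" "(p ^^ card (orbit p x)) x = x"
    "inj_on (\<lambda>j. (p ^^ j) x) {0..<card (orbit p x)}"
    unfolding card using funpow_dist1_prop[OF self] inj by simp_all
  show "orbit p x = (\<lambda>j. (p ^^ j) x) ` {0..<card (orbit p x)}"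
    unfolding card by (rule eq)
qed

text \<open>Starting at \<open>p x\<close> suits products \<open>p \<circ> transpose a b\<close>:
  the transposition exchanges the first steps out of \<open>a\<close> and \<open>b\<close>, so their
  new orbits are runs of iterates of \<open>p\<close> counted from the first step on.\<close>

lemma orbit_eq_image_Suc:
  assumes "(p ^^ n) x = x" "0 < n"
  shows "orbit p x = (\<lambda>j. (p ^^ Suc j) x) ` {0..<n}"
proof -
  have "orbit p x = (\<lambda>j. (p ^^ j) x) ` {0..<n}"
    using orbit_altdef_bounded[OF assms] by auto
  moreover have "x \<in> orbit p x"
    using assms unfolding orbit_altdef by (metis (mono_tags, lifting) mem_Collect_eq)
  then have "p ` orbit p x = orbit p x"
    by (metis orbit_inverse self_in_orbit_step)
  ultimately have "orbit p x = p ` (\<lambda>j. (p ^^ j) x) ` {0..<n}" by simp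
  then show ?thesis by (simp add: image_image)
qed

lemma orbit_eq_or_disjoint:
  assumes "finite V" "p permutes V"
  shows "orbit p x = orbit p y \<or> orbit p x \<inter> orbit p y = {}"
proof -
  have "cyclic_on p (orbit p x)" "cyclic_on p (orbit p y)"
    by (rule cyclic_on_orbit[OF assms(2,1)])+
  then show ?thesis
    using orbit_cyclic_eq3[of p] by blast
qed

text \<open>The transposition acts trivially while the current point avoids \<open>a\<close> and
  \<open>b\<close>. The final point \<open>(p ^^ Suc n) x\<close> may be one of them, so an orbit
  can be followed until it closes up or crosses over.\<close>

lemma funpow_comp_transpose:
  assumes "\<And>j. 0 < j \<Longrightarrow> j \<le> n \<Longrightarrow> (p ^^ j) x \<noteq> a \<and> (p ^^ j) x \<noteq> b"
  shows "((p \<circ> transpose a b) ^^ n) (p x) = (p ^^ Suc n) x"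
  using assms
proof (induction n)
  case (Suc n)
  then have IH: "((p \<circ> transpose a b) ^^ n) (p x) = (p ^^ Suc n) x" by (metis le_SucI)
  have "((p \<circ> transpose a b) ^^ Suc n) (p x) = p (transpose a b ((p ^^ Suc n) x))"
    by (simp only: IH funpow.simps(2)[of n "p \<circ> transpose a b"] o_apply)
  also have "transpose a b ((p ^^ Suc n) x) = (p ^^ Suc n) x"
    using Suc.prems[of "Suc n"] by (intro transpose_apply_other) auto
  finally show ?case by simp
qed simp

text \<open>Version of \<open>perm_cycles\<close> over an arbitrary ground set, so that points can
  be inserted in inductions.\<close>

definition cycles :: "'a set \<Rightarrow> ('a \<Rightarrow> 'a) \<Rightarrow> 'a set set" where
  "cycles V p = orbit p ` V"

text \<open>On an orbit of \<open>p\<close> containing neither \<open>a\<close> nor \<open>b\<close>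
  the two permutations agree, so only the orbits of these two points have to be recomputed, in a
  join as in a split.\<close>

lemma cycles_comp_transpose:
  assumes V: "finite V" "p permutes V" and ab: "a \<in> V" "b \<in> V"
  shows "cycles V (p \<circ> transpose a b) = cycles V p - {orbit p a, orbit p b}
    \<union> orbit (p \<circ> transpose a b) ` (orbit p a \<union> orbit p b)"
proof -
  let ?q = "p \<circ> transpose a b"
  have perm: "permutation p" using V permutation_permutes by blast
  have self: "x \<in> orbit p x" for x by (rule permutation_self_in_orbit[OF perm])
  have other: "orbit ?q x = orbit p x" if "x \<notin> orbit p a \<union> orbit p b" for x
  proof (rule orbit_cong[OF self])
    fix s assume "s \<in> orbit p x"
    then have "orbit p s = orbit p x"
      using orbit_eq_or_disjoint[OF V, of s x] self by blast
    then have "s \<noteq> a" "s \<noteq> b"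
      using that self[of x] by auto
    then show "?q s = p s" by simp
  qed
  have sub: "orbit p a \<union> orbit p b \<subseteq> V"
    using permutes_orbit_subset[OF V(2)] ab by auto
  have mem: "x \<in> orbit p y \<longleftrightarrow> orbit p x = orbit p y" for x y
    using self orbit_eq_or_disjoint[OF V] by blast
  have "cycles V ?q = orbit ?q ` (V - (orbit p a \<union> orbit p b)) \<union> orbit ?q ` (orbit p a \<union> orbit p b)"
    unfolding cycles_def using sub by blast
  also have "orbit ?q ` (V - (orbit p a \<union> orbit p b)) = orbit p ` (V - (orbit p a \<union> orbit p b))"
    using other by auto
  also have "\<dots> = cycles V p - {orbit p a, orbit p b}"
    unfolding cycles_def using mem by auto
  finally show ?thesis .
qed

text \<open>From \<open>a\<close> the product steps to \<open>p b\<close>, follows the cycle of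
  \<open>b\<close> up to \<open>b\<close>, then steps to \<open>p a\<close> and follows the cycle of
  \<open>a\<close> back to \<open>a\<close>.\<close>

lemma cycles_join:
  assumes V: "finite V" "p permutes V" and ab: "a \<in> V" "b \<in> V"
    and neq: "orbit p a \<noteq> orbit p b"
  shows "cycles V (p \<circ> transpose a b)
    = insert (orbit p a \<union> orbit p b) (cycles V p - {orbit p a, orbit p b})"
proof -
  let ?q = "p \<circ> transpose a b"
  have disj: "orbit p a \<inter> orbit p b = {}" using orbit_eq_or_disjoint[OF V] neq by blast
  have q: "?q permutes V" using V ab by (intro permutes_compose permutes_swap_id) auto
  have self: "x \<in> orbit p x" for x
    using V permutation_permutes permutation_self_in_orbit by metis
  define m where "m = card (orbit p a)"
  define k where "k = card (orbit p b)"
  note pa = orbit_period[OF V, of a, folded m_def] and pb = orbit_period[OF V, of b, folded k_def]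
  have notin: "(p ^^ j) a \<noteq> b" "(p ^^ j) b \<noteq> a" for j
    using disj self[of a] self[of b] funpow_in_orbit[OF self, of j a] funpow_in_orbit[OF self, of j b]
    by auto
  have na: "(p ^^ j) a \<noteq> a" if "0 < j" "j < m" for j
    using inj_onD[OF pa(3), of j 0] that by auto
  have nb: "(p ^^ j) b \<noteq> b" if "0 < j" "j < k" for j
    using inj_onD[OF pb(3), of j 0] that by auto
  have qa: "(?q ^^ Suc j) a = (p ^^ Suc j) b" if "j < k" for j
  proof -
    have "(?q ^^ Suc j) a = (?q ^^ j) (p b)" by (simp add: funpow_swap1)
    also have "\<dots> = (p ^^ Suc j) b"
      using that nb notin by (intro funpow_comp_transpose) auto
    finally show ?thesis .
  qed
  have qb: "(?q ^^ Suc j) b = (p ^^ Suc j) a" if "j < m" for j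
  proof -
    have "(?q ^^ Suc j) b = (?q ^^ j) (p a)" by (simp add: funpow_swap1)
    also have "\<dots> = (p ^^ Suc j) a"
      using that na notin by (intro funpow_comp_transpose) auto
    finally show ?thesis .
  qed
  \<comment> \<open>A full traversal of the cycle of \<open>b\<close> (length \<open>k\<close>) ends
    at \<open>b\<close>, one of the cycle of \<open>a\<close> (length \<open>m\<close>) at
    \<open>a\<close>; hence the two points share an orbit.\<close>
  have "(?q ^^ k) a = b" "(?q ^^ m) b = a"
    using qa[of "k - 1"] qb[of "m - 1"] pa(1,2) pb(1,2) by auto
  then have "b \<in> orbit ?q a" "a \<in> orbit ?q b"
    using pa(1) pb(1) unfolding orbit_altdef by (metis (mono_tags, lifting) mem_Collect_eq)+
  then have qab: "orbit ?q a = orbit ?q b"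
    using orbit_trans[of _ ?q] by blast
  have "(?q ^^ Suc j) x \<in> orbit ?q x" for j x
    unfolding orbit_altdef by blast
  then have "orbit p b \<subseteq> orbit ?q a" "orbit p a \<subseteq> orbit ?q b"
    unfolding orbit_eq_image_Suc[OF pb(2,1)] orbit_eq_image_Suc[OF pa(2,1)]
    using qa qb by (metis (no_types, lifting) atLeastLessThan_iff image_subsetI)+
  have "orbit ?q a \<subseteq> orbit p a \<union> orbit p b"
  proof
    fix x assume "x \<in> orbit ?q a"
    then show "x \<in> orbit p a \<union> orbit p b"
    proof induction
      case base
      then show ?case by (auto intro: orbit.base)
    next
      case (step y)
      then show ?case by (auto simp: transpose_def intro: orbit.intros)
    qed
  qed
  with qab \<open>orbit p b \<subseteq> _\<close> \<open>orbit p a \<subseteq> _\<close> have eq: "orbit ?q a = orbit p a \<union> orbit p b" by blast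
  moreover have "orbit ?q x = orbit ?q a" if "x \<in> orbit p a \<union> orbit p b" for x
    using that eq orbit_cyclic_eq3[OF cyclic_on_orbit[OF q V(1)]] by blast
  then have "orbit ?q ` (orbit p a \<union> orbit p b) = {orbit ?q a}"
    using self by blast
  ultimately show ?thesis
    using cycles_comp_transpose[OF V ab] by simp
qed

text \<open>Put \<open>a = (p ^^ i) y\<close> and let \<open>k\<close> be the length of the cycle of
  \<open>y\<close>. The product runs from \<open>a\<close> through
  \<open>p y, ..., (p ^^ i) y = a\<close>, and from \<open>y\<close> through
  \<open>(p ^^ (i + 1)) y, ..., (p ^^ k) y = y\<close>.\<close>

lemma cycles_split:
  assumes V: "finite V" "p permutes V" and y: "y \<in> V"
    and i: "0 < i" "i < card (orbit p y)"
  obtains X Y where "X \<union> Y = orbit p y" "X \<inter> Y = {}" "card X = i" "card Y = card (orbit p y) - i"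
    "cycles V (p \<circ> transpose ((p ^^ i) y) y) = insert X (insert Y (cycles V p - {orbit p y}))"
proof -
  define k where "k = card (orbit p y)"
  define a where "a = (p ^^ i) y"
  let ?q = "p \<circ> transpose a y"
  note py = orbit_period[OF V, of y, folded k_def]
  have ik: "0 < i" "i < k" using i k_def by auto
  have self: "x \<in> orbit p x" for x
    using V permutation_permutes permutation_self_in_orbit by metis
  have a: "a \<in> orbit p y" unfolding a_def by (rule funpow_in_orbit[OF self])
  then have aV: "a \<in> V" using permutes_orbit_subset[OF V(2) y] by blast
  have oa: "orbit p a = orbit p y" using a V orbit_eq_or_disjoint[OF V, of a y] self by blast
  have q: "?q permutes V" using V y aV by (intro permutes_compose permutes_swap_id) auto
  have inj: "(p ^^ j) y \<noteq> (p ^^ l) y" if "j < k" "l < k" "j \<noteq> l" for j l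
    using inj_onD[OF py(3), of j l] that by auto
  have qa: "(?q ^^ Suc j) a = (p ^^ Suc j) y" if "j < i" for j
  proof -
    have "(?q ^^ Suc j) a = (?q ^^ j) (p y)" by (simp add: funpow_swap1)
    also have "\<dots> = (p ^^ Suc j) y"
    proof (rule funpow_comp_transpose)
      fix l assume "0 < l" "l \<le> j"
      then show "(p ^^ l) y \<noteq> a \<and> (p ^^ l) y \<noteq> y"
        unfolding a_def using inj[of l i] inj[of l 0] that ik by auto
    qed
    finally show ?thesis .
  qed
  have qy: "(?q ^^ Suc j) y = (p ^^ (i + Suc j)) y" if "j < k - i" for j
  proof -
    have "(?q ^^ Suc j) y = (?q ^^ j) (p a)" by (simp add: funpow_swap1)
    also have "\<dots> = (p ^^ Suc j) a"
    proof (rule funpow_comp_transpose)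
      fix l assume "0 < l" "l \<le> j"
      then have "(p ^^ (l + i)) y \<noteq> a \<and> (p ^^ (l + i)) y \<noteq> y"
        unfolding a_def using inj[of "l + i" i] inj[of "l + i" 0] that ik by auto
      then show "(p ^^ l) a \<noteq> a \<and> (p ^^ l) a \<noteq> y"
        unfolding a_def by (simp add: funpow_add)
    qed
    also have "\<dots> = (p ^^ (Suc j + i)) y" by (simp only: a_def funpow_add o_apply)
    finally show ?thesis by (simp only: add.commute)
  qed
  have qai: "(?q ^^ i) a = a" using qa[of "i - 1"] ik by (simp add: a_def)
  have qyk: "(?q ^^ (k - i)) y = y"
  proof -
    have "(?q ^^ Suc (k - i - 1)) y = (p ^^ (i + Suc (k - i - 1))) y"
      using ik by (intro qy) auto
    moreover have "Suc (k - i - 1) = k - i" "i + Suc (k - i - 1) = k" using ik by auto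
    ultimately show ?thesis using py(2) by metis
  qed
  \<comment> \<open>Index \<open>j\<close> stands for iterate \<open>j + 1\<close>, so that the
    first \<open>i\<close> indices give the orbit of \<open>a\<close> and the others the orbit of
    \<open>y\<close>.\<close>
  let ?f = "\<lambda>j. (p ^^ Suc j) y"
  have f_inj: "inj_on ?f {0..<k}"
  proof (rule inj_onI)
    fix j l assume "j \<in> {0..<k}" "l \<in> {0..<k}" "?f j = ?f l"
    then show "j = l"
      using permutes_inj[OF V(2)] inj[of j l] by (auto dest: injD)
  qed
  have X: "orbit ?q a = ?f ` {0..<i}"
    unfolding orbit_eq_image_Suc[OF qai ik(1)] using qa by (intro image_cong) auto
  have "orbit ?q y = (\<lambda>j. (?q ^^ Suc j) y) ` {0..<k - i}"
    using orbit_eq_image_Suc[OF qyk] ik by simp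
  also have "\<dots> = (\<lambda>j. ?f (i + j)) ` {0..<k - i}"
    using qy by (intro image_cong) (auto simp del: funpow.simps)
  also have "\<dots> = ?f ` ((+) i ` {0..<k - i})" by (simp only: image_image)
  also have "(+) i ` {0..<k - i} = {i..<k}" using ik by (simp add: image_add_atLeastLessThan)
  finally have Y: "orbit ?q y = ?f ` {i..<k}" .
  have split: "{0..<i} \<union> {i..<k} = {0..<k}" using ik by auto
  have un: "orbit ?q a \<union> orbit ?q y = orbit p y"
    unfolding X Y image_Un[symmetric] split using orbit_eq_image_Suc[OF py(2,1)] by simp
  have disj: "orbit ?q a \<inter> orbit ?q y = {}"
    unfolding X Y using f_inj ik by (subst inj_on_image_Int[symmetric, of _ "{0..<k}"]) auto
  have "orbit ?q x \<in> {orbit ?q a, orbit ?q y}" if "x \<in> orbit p y" for x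
  proof -
    have "x \<in> orbit ?q a \<or> x \<in> orbit ?q y" using that un by blast
    then show ?thesis
      using orbit_cyclic_eq3[OF cyclic_on_orbit[OF q V(1)]] by blast
  qed
  then have "orbit ?q ` orbit p y = {orbit ?q a, orbit ?q y}"
    using a self[of y] by blast
  then have cyc: "cycles V ?q = insert (orbit ?q a) (insert (orbit ?q y) (cycles V p - {orbit p y}))"
    using cycles_comp_transpose[OF V aV y] oa by auto
  have "card (orbit ?q a) = i" "card (orbit ?q y) = k - i"
    unfolding X Y using ik by (subst card_image; auto intro!: inj_on_subset[OF f_inj] simp del: funpow.simps)+
  with un disj cyc show ?thesis using that unfolding a_def k_def by blast
qed

section \<open>Conjugation invariance and insertion of a point\<close>

lemma finite_cycles [simp]: "finite V \<Longrightarrow> finite (cycles V p)"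
  by (simp add: cycles_def)

text \<open>The two products are conjugate,
  \<open>r \<circ> p = r \<circ> (p \<circ> r) \<circ> inv r\<close>, so \<open>r\<close> carries
  cycles to cycles.\<close>

lemma cycles_comp_commute:
  assumes "finite V" "p permutes V" "r permutes V"
  shows "cycles V (r \<circ> p) = (`) r ` cycles V (p \<circ> r)"
proof -
  have "r ` orbit (p \<circ> r) x = orbit (r \<circ> p) (r x)" for x
  proof (rule orbit_inverse)
    have "permutation (p \<circ> r)"
      using assms permutation_permutes permutes_compose by blast
    then show "x \<in> orbit (p \<circ> r) x" by (rule permutation_self_in_orbit)
  qed simp
  then have "(`) r ` cycles V (p \<circ> r) = orbit (r \<circ> p) ` r ` V"
    unfolding cycles_def image_image by (rule image_cong[OF refl])
  also have "r ` V = V" using assms(3) by (rule permutes_image)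
  finally show ?thesis unfolding cycles_def by (rule sym)
qed

lemma card_cycles_comp_commute:
  assumes "finite V" "p permutes V" "r permutes V"
  shows "card (cycles V (r \<circ> p)) = card (cycles V (p \<circ> r))"
proof -
  have "inj ((`) r)" using permutes_inj[OF assms(3)] by (simp add: inj_image_eq_iff inj_def)
  then show ?thesis
    unfolding cycles_comp_commute[OF assms] by (meson card_image inj_on_subset subset_UNIV)
qed

lemma cycles_insert_fixed:
  assumes "p permutes V" "e \<notin> V"
  shows "cycles (insert e V) p = insert {e} (cycles V p)"
  using permutes_not_in[OF assms] orbit_eq_singleton_iff[of p e] by (simp add: cycles_def)

lemma cycle_subset:
  assumes "p permutes V" "C \<in> cycles V p"
  shows "C \<subseteq> V"
  using assms permutes_orbit_subset by (fastforce simp: cycles_def)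

lemma card_cycles_insert_fixed:
  assumes "finite V" "p permutes V" "e \<notin> V"
  shows "card (cycles (insert e V) p) = Suc (card (cycles V p))"
proof -
  have "{e} \<notin> cycles V p" using cycle_subset[OF assms(2)] assms(3) by blast
  then show ?thesis using assms by (simp add: cycles_insert_fixed)
qed

text \<open>Since \<open>p\<close> fixes \<open>e\<close>, this is a join with the one-point cycle
  of \<open>e\<close>.\<close>

lemma cycles_insert:
  assumes "finite V" "p permutes V" "e \<notin> V" "a \<in> V"
  shows "cycles (insert e V) (p \<circ> transpose a e)
    = insert (insert e (orbit p a)) (cycles V p - {orbit p a})"
proof -
  have e: "orbit p e = {e}"
    using permutes_not_in[OF assms(2,3)] orbit_eq_singleton_iff[of p e] by simp
  have "orbit p a \<subseteq> V" using assms permutes_orbit_subset by metis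
  then have "orbit p a \<noteq> orbit p e" using e assms(3) by auto
  moreover have "{e} \<notin> cycles V p" using cycle_subset[OF assms(2)] assms(3) by blast
  ultimately show ?thesis
    using assms cycles_join[of "insert e V" p a e] permutes_subset[OF assms(2), of "insert e V"]
    by (auto simp: e cycles_insert_fixed)
qed

lemma card_cycles_insert:
  assumes "finite V" "p permutes V" "e \<notin> V" "a \<in> V"
  shows "card (cycles (insert e V) (p \<circ> transpose a e)) = card (cycles V p)"
proof -
  have "insert e (orbit p a) \<notin> cycles V p" using cycle_subset[OF assms(2)] assms(3) by blast
  moreover have "orbit p a \<in> cycles V p" using assms by (simp add: cycles_def)
  then have "card (cycles V p) > 0" using assms(1) by (auto simp: card_gt_0_iff)
  ultimately show ?thesis
    using assms \<open>orbit p a \<in> cycles V p\<close> by (simp add: cycles_insert)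
qed

section \<open>Products with full cycles\<close>

definition full_cycles :: "'a set \<Rightarrow> ('a \<Rightarrow> 'a) set" where
  "full_cycles V = {w. w permutes V \<and> card (cycles V w) = 1}"

text \<open>\<open>w \<circ> transpose a e\<close> places \<open>e\<close> between \<open>a\<close>
  and \<open>w a\<close>; composing with the same transposition again deletes it. The one-point
  cycle on \<open>e\<close> does not arise by insertion, hence \<open>V\<close> is nonempty.\<close>

lemma full_cycles_insert:
  assumes "finite V" "V \<noteq> {}" "e \<notin> V"
  shows "bij_betw (\<lambda>(a, w). w \<circ> transpose a e) (V \<times> full_cycles V) (full_cycles (insert e V))"
  unfolding bij_betw_def
proof (intro conjI inj_onI subset_antisym subsetI; clarify?)
  fix a w b v
  assume *: "a \<in> V" "w \<in> full_cycles V" "b \<in> V" "v \<in> full_cycles V"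
    and eq: "w \<circ> transpose a e = v \<circ> transpose b e"
  have fix_e: "w e = e" "v e = e"
    using * assms(3) permutes_not_in unfolding full_cycles_def by fastforce+
  have "v (transpose b e a) = e" using fun_cong[OF eq, of a] fix_e by simp
  then have "v (transpose b e a) = v e" using fix_e by simp
  then have "transpose b e a = e"
    using * permutes_inj[of v V] unfolding full_cycles_def by (auto dest: injD)
  then have "a = b" using * assms(3) by (auto simp: transpose_eq_iff)
  moreover have "w = (v \<circ> transpose b e) \<circ> transpose a e"
    by (simp add: eq[symmetric] comp_assoc)
  ultimately show "a = b \<and> w = v" by (simp add: comp_assoc)
next
  fix a w assume "a \<in> V" "w \<in> full_cycles V"
  then show "w \<circ> transpose a e \<in> full_cycles (insert e V)"
    using assms card_cycles_insert[of V w e a] permutes_subset[of w V "insert e V"]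
    unfolding full_cycles_def by (auto intro: permutes_compose permutes_swap_id)
next
  fix u assume "u \<in> full_cycles (insert e V)"
  then have u: "u permutes insert e V" "card (cycles (insert e V) u) = 1"
    by (auto simp: full_cycles_def)
  \<comment> \<open>The predecessor of \<open>e\<close> in \<open>u\<close> is the only candidate
    for the insertion place.\<close>
  define a where "a = inv u e"
  have ua: "u a = e" unfolding a_def by (rule permutes_inverses[OF u(1)])
  define w where "w = u \<circ> transpose a e"
  have u_eq: "u = w \<circ> transpose a e" by (simp add: w_def comp_assoc)
  have "a \<in> insert e V" using ua permutes_in_image[OF u(1), of a] by simp
  have w_ins: "w permutes insert e V"
    unfolding w_def using \<open>a \<in> _\<close> by (intro permutes_compose u permutes_swap_id) auto
  have w: "w permutes V"
    by (rule permutes_superset[OF w_ins]) (auto simp: w_def ua)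
  \<comment> \<open>Otherwise \<open>a = e\<close>, so \<open>{e}\<close> is the only cycle of
    \<open>u\<close> and none is left for the nonempty \<open>V\<close>.\<close>
  have "a \<in> V"
  proof (rule ccontr)
    assume "a \<notin> V"
    then have "u permutes V" using \<open>a \<in> insert e V\<close> w u_eq by simp
    then have "cycles V u = {}"
      using u(2) card_cycles_insert_fixed[of V u e] assms by (simp add: card_eq_0_iff)
    then show False using assms(2) by (simp add: cycles_def)
  qed
  moreover have "w \<in> full_cycles V"
    using w u(2) assms card_cycles_insert[OF assms(1) w assms(3) \<open>a \<in> V\<close>] u_eq
    by (simp add: full_cycles_def)
  ultimately show "u \<in> (\<lambda>(a, w). w \<circ> transpose a e) ` (V \<times> full_cycles V)"
    using u_eq by auto
qed

text \<open>\<open>inv s \<circ> w\<close> is the unique \<open>p\<close> with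
  \<open>s \<circ> p = w\<close>. The polynomial is kept as a function of a real \<open>x\<close>
  because its closed form uses generalized binomial coefficients.\<close>

definition cycle_gf :: "'a set \<Rightarrow> ('a \<Rightarrow> 'a) \<Rightarrow> real \<Rightarrow> real" where
  "cycle_gf V s x = (\<Sum>w\<in>full_cycles V. x ^ card (cycles V (inv s \<circ> w)))"

lemma cycle_gf_insert:
  assumes "finite V" "V \<noteq> {}" "e \<notin> V"
  shows "cycle_gf (insert e V) s x
    = (\<Sum>a\<in>V. \<Sum>w\<in>full_cycles V. x ^ card (cycles (insert e V) (inv s \<circ> (w \<circ> transpose a e))))"
  unfolding cycle_gf_def sum.reindex_bij_betw[OF full_cycles_insert[OF assms], symmetric]
  by (simp add: sum.cartesian_product case_prod_unfold)

text \<open>As \<open>s\<close> fixes \<open>e\<close>, the point \<open>e\<close> merely joins an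
  existing cycle of \<open>inv s \<circ> w\<close>, whichever of the \<open>card V\<close> places
  \<open>a\<close> it takes.\<close>

lemma cycle_gf_insert_fixed:
  assumes "finite V" "V \<noteq> {}" "e \<notin> V" and s: "s permutes V"
  shows "cycle_gf (insert e V) s x = card V * cycle_gf V s x"
proof -
  have "card (cycles (insert e V) (inv s \<circ> (w \<circ> transpose a e))) = card (cycles V (inv s \<circ> w))"
    if "a \<in> V" "w \<in> full_cycles V" for a w
  proof -
    have "inv s \<circ> w permutes V"
      using that s by (auto simp: full_cycles_def intro: permutes_compose permutes_inv)
    from card_cycles_insert[OF assms(1) this assms(3) that(1)] show ?thesis
      by (simp add: comp_assoc)
  qed
  then show ?thesis unfolding cycle_gf_insert[OF assms(1-3)] by (simp add: cycle_gf_def)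
qed

text \<open>Inverting \<open>s \<circ> transpose y e\<close> puts the transposition in front, and
  conjugation moves it to the end:
  \<open>inv s \<circ> w \<circ> transpose a e \<circ> transpose y e\<close>. For
  \<open>a = y\<close> the transpositions cancel and the fixed point \<open>e\<close> contributes
  the factor \<open>x\<close>.\<close>

lemma cycle_gf_insert_moved:
  assumes "finite V" "e \<notin> V" and s: "s permutes V" and y: "y \<in> V"
  shows "cycle_gf (insert e V) (s \<circ> transpose y e) x
    = x * cycle_gf V s x + (\<Sum>a\<in>V - {y}. cycle_gf V (s \<circ> transpose a y) x)"
proof -
  have "V \<noteq> {}" using y by auto
  let ?E = "insert e V"
  have inv_s: "inv (s \<circ> transpose a b) = transpose a b \<circ> inv s" for a b
    using o_inv_distrib[OF permutes_bij[OF s], of "transpose a b"] by simp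
  have sE: "inv s permutes ?E"
    using permutes_inv[OF s] permutes_subset by (metis subset_insertI)
  have rot: "card (cycles ?E (inv (s \<circ> transpose y e) \<circ> (w \<circ> transpose a e)))
      = card (cycles ?E (inv s \<circ> w \<circ> transpose a e \<circ> transpose y e))"
    if "a \<in> V" "w \<in> full_cycles V" for a w
  proof -
    have "w permutes ?E"
      using that permutes_subset by (metis (no_types, lifting) full_cycles_def mem_Collect_eq subset_insertI)
    then have "inv s \<circ> w \<circ> transpose a e permutes ?E"
      using that(1) sE by (intro permutes_compose permutes_swap_id) auto
    from card_cycles_comp_commute[OF _ this, of "transpose y e"] show ?thesis
      using assms(1) y by (simp add: permutes_swap_id inv_s comp_assoc)
  qed
  have same: "card (cycles ?E (inv (s \<circ> transpose y e) \<circ> (w \<circ> transpose y e)))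
      = Suc (card (cycles V (inv s \<circ> w)))" if "w \<in> full_cycles V" for w
  proof -
    have "inv s \<circ> w permutes V"
      using that s by (auto simp: full_cycles_def intro: permutes_compose permutes_inv)
    from card_cycles_insert_fixed[OF assms(1) this assms(2)] show ?thesis
      unfolding rot[OF y that] by (simp add: comp_assoc)
  qed
  have diff: "card (cycles ?E (inv (s \<circ> transpose y e) \<circ> (w \<circ> transpose a e)))
      = card (cycles V (inv (s \<circ> transpose a y) \<circ> w))" if "a \<in> V" "a \<noteq> y" "w \<in> full_cycles V" for a w
  proof -
    have p: "inv s \<circ> w permutes V"
      using that s by (auto simp: full_cycles_def intro: permutes_compose permutes_inv)
    then have q: "inv s \<circ> w \<circ> transpose a y permutes V"
      by (rule permutes_compose[OF permutes_swap_id[OF that(1) y]])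
    \<comment> \<open>Both sides are the 3-cycle taking \<open>y\<close> to \<open>a\<close>,
      \<open>a\<close> to \<open>e\<close> and \<open>e\<close> to \<open>y\<close>. In the second
      form \<open>e\<close> is inserted after \<open>a\<close> and can be deleted without changing
      the number of cycles.\<close>
    have "transpose a e \<circ> transpose y e = transpose a y \<circ> transpose a e"
      using that y assms(2) by (auto simp: fun_eq_iff transpose_def)
    then have "inv s \<circ> w \<circ> transpose a e \<circ> transpose y e = (inv s \<circ> w \<circ> transpose a y) \<circ> transpose a e"
      by (simp add: comp_assoc)
    then have "card (cycles ?E (inv (s \<circ> transpose y e) \<circ> (w \<circ> transpose a e)))
      = card (cycles V (inv s \<circ> w \<circ> transpose a y))"
      using rot[OF that(1,3)] card_cycles_insert[OF assms(1) q assms(2) that(1)] by simp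
    also have "\<dots> = card (cycles V (transpose a y \<circ> (inv s \<circ> w)))"
      using card_cycles_comp_commute[OF assms(1) p, of "transpose a y"] that(1) y
      by (simp add: permutes_swap_id)
    finally show ?thesis by (simp add: inv_s comp_assoc)
  qed
  have "cycle_gf ?E (s \<circ> transpose y e) x = (\<Sum>w\<in>full_cycles V. x ^ Suc (card (cycles V (inv s \<circ> w))))
      + (\<Sum>a\<in>V - {y}. \<Sum>w\<in>full_cycles V. x ^ card (cycles V (inv (s \<circ> transpose a y) \<circ> w)))"
    unfolding cycle_gf_insert[OF assms(1) \<open>V \<noteq> {}\<close> assms(2)] sum.remove[OF assms(1) y]
    by (intro arg_cong2[where f="(+)"] sum.cong refl) (simp_all add: same diff)
  then show ?thesis by (simp add: cycle_gf_def sum_distrib_left)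
qed

section \<open>The cycle type polynomial\<close>

text \<open>\<open>[:1, 1:]\<close> is 1 + z. Subtracting 1 removes the constant term, which later
  forces the parts of the compositions to be positive.\<close>

definition cycle_poly :: "nat \<Rightarrow> real poly" where
  "cycle_poly k = [:1, 1:] ^ k - 1"

definition cycles_poly :: "'a set \<Rightarrow> ('a \<Rightarrow> 'a) \<Rightarrow> real poly" where
  "cycles_poly V p = (\<Prod>C\<in>cycles V p. cycle_poly (card C))"

lemma degree_cycle_poly: "degree (cycle_poly k) \<le> k"
  unfolding cycle_poly_def
  by (intro degree_diff_le order.trans[OF degree_power_le]) auto

lemma cycle_poly_1 [simp]: "cycle_poly (Suc 0) = [:0, 1:]"
  by (simp add: cycle_poly_def one_pCons)

lemma Union_cycles:
  assumes "finite V" "p permutes V"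
  shows "\<Union> (cycles V p) = V"
proof -
  have "x \<in> orbit p x" for x
    using assms permutation_permutes permutation_self_in_orbit by metis
  then show ?thesis using cycle_subset[OF assms(2)] by (auto simp: cycles_def)
qed

lemma disjoint_cycles:
  assumes "finite V" "p permutes V" "C \<in> cycles V p" "D \<in> cycles V p" "C \<noteq> D"
  shows "C \<inter> D = {}"
  using assms orbit_eq_or_disjoint[OF assms(1,2)] unfolding cycles_def by blast

lemma sum_card_cycles:
  assumes "finite V" "p permutes V"
  shows "(\<Sum>C\<in>cycles V p. card C) = card V"
proof -
  have "finite C" if "C \<in> cycles V p" for C
    using cycle_subset[OF assms(2) that] assms(1) by (rule finite_subset)
  then have "card (\<Union> (cycles V p)) = (\<Sum>C\<in>cycles V p. card C)"
    using disjoint_cycles[OF assms] by (intro card_Union_disjoint) (auto simp: pairwise_def disjnt_def)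
  then show ?thesis using Union_cycles[OF assms] by simp
qed

lemma degree_cycles_poly:
  assumes "finite V" "p permutes V"
  shows "degree (cycles_poly V p) \<le> card V"
proof -
  have "degree (cycles_poly V p) \<le> (\<Sum>C\<in>cycles V p. degree (cycle_poly (card C)))"
    unfolding cycles_poly_def by (rule degree_prod_sum_le[unfolded comp_def]) (simp add: assms)
  also have "\<dots> \<le> (\<Sum>C\<in>cycles V p. card C)" by (intro sum_mono degree_cycle_poly)
  finally show ?thesis using sum_card_cycles[OF assms] by simp
qed

lemma cycles_poly_remove:
  assumes "finite V" "y \<in> V"
  shows "cycles_poly V p = cycle_poly (card (orbit p y)) *
    (\<Prod>C\<in>cycles V p - {orbit p y}. cycle_poly (card C))"
  unfolding cycles_poly_def using assms by (intro prod.remove) (auto simp: cycles_def)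

lemma cycles_poly_insert_fixed:
  assumes "finite V" "p permutes V" "e \<notin> V"
  shows "cycles_poly (insert e V) p = [:0, 1:] * cycles_poly V p"
proof -
  have "{e} \<notin> cycles V p" using cycle_subset[OF assms(2)] assms(3) by blast
  then show ?thesis using assms by (simp add: cycles_poly_def cycles_insert_fixed)
qed

lemma cycles_poly_insert_moved:
  assumes "finite V" "p permutes V" "e \<notin> V" "y \<in> V"
  shows "cycles_poly (insert e V) (p \<circ> transpose y e) = cycle_poly (Suc (card (orbit p y))) *
    (\<Prod>C\<in>cycles V p - {orbit p y}. cycle_poly (card C))"
proof -
  have sub: "orbit p y \<subseteq> V" using permutes_orbit_subset assms by metis
  then have "card (insert e (orbit p y)) = Suc (card (orbit p y))"
    using assms finite_subset by (subst card_insert_disjoint) auto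
  moreover have "insert e (orbit p y) \<notin> cycles V p"
    using cycle_subset[OF assms(2)] assms(3) by blast
  ultimately show ?thesis
    unfolding cycles_poly_def cycles_insert[OF assms] using assms(1)
    by (subst prod.insert) auto
qed

lemma cycles_poly_split:
  assumes V: "finite V" "p permutes V" and y: "y \<in> V"
    and i: "0 < i" "i < card (orbit p y)"
  shows "cycles_poly V (p \<circ> transpose ((p ^^ i) y) y) =
    cycle_poly i * cycle_poly (card (orbit p y) - i) *
    (\<Prod>C\<in>cycles V p - {orbit p y}. cycle_poly (card C))"
proof -
  obtain X Y where XY: "X \<union> Y = orbit p y" "X \<inter> Y = {}" "card X = i" "card Y = card (orbit p y) - i"
    "cycles V (p \<circ> transpose ((p ^^ i) y) y) = insert X (insert Y (cycles V p - {orbit p y}))"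
    using cycles_split[OF assms] .
  have "orbit p y \<in> cycles V p" using y by (simp add: cycles_def)
  then have "C \<inter> orbit p y = {}" if "C \<in> cycles V p - {orbit p y}" for C
    using that disjoint_cycles[OF V] by blast
  moreover have "X \<noteq> {}" "Y \<noteq> {}" using XY i by auto
  \<comment> \<open>The product runs over a set of cycles, so the two pieces must differ from each
    other and from the remaining cycles to contribute separate factors.\<close>
  ultimately have "X \<notin> insert Y (cycles V p - {orbit p y})" "Y \<notin> cycles V p - {orbit p y}"
    using XY(1,2) by blast+
  then show ?thesis
    unfolding cycles_poly_def XY(5) using V(1) XY(3,4) by (simp add: mult.assoc)
qed

lemma cycles_poly_join:
  assumes V: "finite V" "p permutes V" and y: "y \<in> V" "a \<in> V" and neq: "orbit p a \<noteq> orbit p y"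
  shows "cycles_poly V (p \<circ> transpose a y) =
    cycle_poly (card (orbit p y) + card (orbit p a)) *
    (\<Prod>C\<in>cycles V p - {orbit p y} - {orbit p a}. cycle_poly (card C))"
proof -
  have mem: "orbit p y \<in> cycles V p" "orbit p a \<in> cycles V p" using y by (auto simp: cycles_def)
  have disj: "orbit p a \<inter> orbit p y = {}" using disjoint_cycles[OF V mem(2,1) neq] .
  have fin: "finite (orbit p a)" "finite (orbit p y)"
    using V(1) cycle_subset[OF V(2)] mem finite_subset by blast+
  have card: "card (orbit p a \<union> orbit p y) = card (orbit p y) + card (orbit p a)"
    using card_Un_disjoint[OF fin disj] by simp
  have "orbit p a \<union> orbit p y \<notin> cycles V p - {orbit p y} - {orbit p a}"
  proof
    assume "orbit p a \<union> orbit p y \<in> cycles V p - {orbit p y} - {orbit p a}"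
    then have "(orbit p a \<union> orbit p y) \<inter> orbit p a = {}"
      using disjoint_cycles[OF V _ mem(2)] by blast
    then show False using orbit_nonempty[of p a] by blast
  qed
  moreover have "cycles V p - {orbit p a, orbit p y} = cycles V p - {orbit p y} - {orbit p a}" by blast
  ultimately show ?thesis
    unfolding cycles_poly_def cycles_join[OF V y(2,1) neq] using V(1)
    by (subst prod.insert) (auto simp: card)
qed

text \<open>A point \<open>a\<close> on the cycle of \<open>y\<close> splits it into lengths
  \<open>i\<close> and \<open>k - i\<close>, each \<open>i\<close> occurring once. A point of
  another cycle \<open>C\<close> joins the two, with the same result for all \<open>card C\<close>
  choices.\<close>

lemma sum_cycles_poly_transpose:
  assumes V: "finite V" "p permutes V" and y: "y \<in> V"
  defines "k \<equiv> card (orbit p y)" and "\<C> \<equiv> cycles V p - {orbit p y}"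
  shows "(\<Sum>a\<in>V - {y}. cycles_poly V (p \<circ> transpose a y)) =
    (\<Sum>i\<in>{1..<k}. cycle_poly i * cycle_poly (k - i)) * (\<Prod>C\<in>\<C>. cycle_poly (card C)) +
    (\<Sum>C\<in>\<C>. of_nat (card C) * cycle_poly (k + card C) * (\<Prod>D\<in>\<C> - {C}. cycle_poly (card D)))"
proof -
  let ?f = "\<lambda>a. cycles_poly V (p \<circ> transpose a y)"
  have self: "x \<in> orbit p x" for x
    using V permutation_permutes permutation_self_in_orbit by metis
  have mem: "orbit p y \<in> cycles V p" using y by (simp add: cycles_def)
  have fin: "finite C" if "C \<in> cycles V p" for C
    using V(1) cycle_subset[OF V(2) that] finite_subset by blast
  have V_eq: "V = orbit p y \<union> \<Union> \<C>"
    using Union_cycles[OF V] mem unfolding \<C>_def by blast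
  have disj: "orbit p y \<inter> \<Union> \<C> = {}"
    using disjoint_cycles[OF V mem] unfolding \<C>_def by blast
  have orb: "orbit p a = C" if "C \<in> cycles V p" "a \<in> C" for a C
    using that orbit_cyclic_eq3[OF cyclic_on_orbit[OF V(2,1)]] by (auto simp: cycles_def)
  have 1: "(\<Sum>a\<in>orbit p y - {y}. ?f a) =
    (\<Sum>i\<in>{1..<k}. cycle_poly i * cycle_poly (k - i)) * (\<Prod>C\<in>\<C>. cycle_poly (card C))"
  proof -
    note per = orbit_period[OF V, of y, folded k_def]
    have "{0..<k} = insert 0 {1..<k}" using per(1) by auto
    then have "orbit p y = insert y ((\<lambda>j. (p ^^ j) y) ` {1..<k})"
      using per(4) by simp
    moreover have "y \<notin> (\<lambda>j. (p ^^ j) y) ` {1..<k}"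
    proof
      assume "y \<in> (\<lambda>j. (p ^^ j) y) ` {1..<k}"
      then obtain j where "j \<in> {1..<k}" "(p ^^ j) y = (p ^^ 0) y" by auto
      then show False using inj_onD[OF per(3), of j 0] by auto
    qed
    ultimately have "orbit p y - {y} = (\<lambda>j. (p ^^ j) y) ` {1..<k}" by auto
    then have "(\<Sum>a\<in>orbit p y - {y}. ?f a) = (\<Sum>i\<in>{1..<k}. ?f ((p ^^ i) y))"
      using per(3) by (simp add: sum.reindex inj_on_def)
    also have "\<dots> = (\<Sum>i\<in>{1..<k}. cycle_poly i * cycle_poly (k - i) * (\<Prod>C\<in>\<C>. cycle_poly (card C)))"
      unfolding k_def \<C>_def using V y by (intro sum.cong refl cycles_poly_split) auto
    finally show ?thesis by (simp add: sum_distrib_right)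
  qed
  have 2: "(\<Sum>a\<in>\<Union> \<C>. ?f a) =
    (\<Sum>C\<in>\<C>. of_nat (card C) * cycle_poly (k + card C) * (\<Prod>D\<in>\<C> - {C}. cycle_poly (card D)))"
  proof -
    have "(\<Sum>a\<in>\<Union> \<C>. ?f a) = (\<Sum>C\<in>\<C>. \<Sum>a\<in>C. ?f a)"
      using disjoint_cycles[OF V] fin unfolding \<C>_def by (intro sum.Union_disjoint[unfolded comp_def]) auto
    also have "\<dots> = (\<Sum>C\<in>\<C>. \<Sum>a\<in>C. cycle_poly (k + card C) * (\<Prod>D\<in>\<C> - {C}. cycle_poly (card D)))"
    proof (intro sum.cong refl)
      fix C a assume "C \<in> \<C>" "a \<in> C"
      then have "orbit p a = C" "orbit p a \<noteq> orbit p y" "a \<in> V"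
        using orb V_eq unfolding \<C>_def by auto
      then show "?f a = cycle_poly (k + card C) * (\<Prod>D\<in>\<C> - {C}. cycle_poly (card D))"
        using cycles_poly_join[OF V y, of a] unfolding \<C>_def k_def by simp
    qed
    finally show ?thesis by (simp add: mult.assoc)
  qed
  have "V - {y} = (orbit p y - {y}) \<union> \<Union> \<C>" using V_eq disj self[of y] by blast
  moreover have "finite (orbit p y)" "finite (\<Union> \<C>)" "(orbit p y - {y}) \<inter> \<Union> \<C> = {}"
    using V(1) V_eq disj by (auto intro: finite_subset)
  ultimately have "(\<Sum>a\<in>V - {y}. ?f a) = (\<Sum>a\<in>orbit p y - {y}. ?f a) + (\<Sum>a\<in>\<Union> \<C>. ?f a)"
    by (simp add: sum.union_disjoint)
  then show ?thesis using 1 2 by simp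
qed

section \<open>Polynomial identities for joins and splits\<close>

lemma pderiv_cycle_poly: "[:1, 1:] * pderiv (cycle_poly m) = of_nat m * [:1, 1:] ^ m"
proof -
  define q :: "real poly" where "q = [:1, 1:]"
  have q: "pderiv q = 1" by (simp add: q_def pderiv_pCons)
  show ?thesis
    unfolding cycle_poly_def q_def[symmetric]
    by (cases m) (simp_all add: pderiv_diff pderiv_power_Suc q of_nat_poly del: power_Suc,
      simp add: power_Suc)
qed

text \<open>Since \<open>q p\<^sub>m' = m p\<^sub>m + m\<close> for \<open>q = 1 + z\<close> and \<open>p\<^sub>m = q\<^sup>m - 1\<close>,
  the sum over all joins is a derivative of the product over the other cycles.\<close>

lemma cycle_poly_join_sum:
  assumes "finite \<C>"
  shows "(\<Sum>C\<in>\<C>. of_nat (card C) * cycle_poly (k + card C) * (\<Prod>D\<in>\<C> - {C}. cycle_poly (card D)))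
    = of_nat (\<Sum>C\<in>\<C>. card C) * (\<Prod>C\<in>\<C>. cycle_poly (card C))
      + [:1, 1:] * cycle_poly k * pderiv (\<Prod>C\<in>\<C>. cycle_poly (card C))"
proof -
  have deriv: "[:1, 1:] * pderiv (cycle_poly m) = of_nat m * (cycle_poly m + 1)" for m
    unfolding pderiv_cycle_poly by (simp add: cycle_poly_def)
  have "of_nat m * cycle_poly (k + m) * r
    = of_nat m * (cycle_poly m * r) + [:1, 1:] * cycle_poly k * (r * pderiv (cycle_poly m))" for m r
  proof -
    have "[:1, 1:] * cycle_poly k * (r * pderiv (cycle_poly m))
      = cycle_poly k * r * (of_nat m * (cycle_poly m + 1))"
      unfolding deriv[symmetric] by (simp only: mult_ac)
    \<comment> \<open>This is (1 + z)^(k + m) - 1 rewritten so that \<open>cycle_poly m + 1\<close>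
      appears, which together with the factor m is the derivative term of
      \<open>deriv\<close>.\<close>
    moreover have "cycle_poly (k + m) = cycle_poly m + cycle_poly k * (cycle_poly m + 1)"
      by (simp add: cycle_poly_def power_add algebra_simps)
    ultimately show ?thesis by (simp only:) (simp only: algebra_simps)
  qed
  then have "(\<Sum>C\<in>\<C>. of_nat (card C) * cycle_poly (k + card C) * (\<Prod>D\<in>\<C> - {C}. cycle_poly (card D)))
    = (\<Sum>C\<in>\<C>. of_nat (card C) * (cycle_poly (card C) * (\<Prod>D\<in>\<C> - {C}. cycle_poly (card D))) +
       [:1, 1:] * cycle_poly k * ((\<Prod>D\<in>\<C> - {C}. cycle_poly (card D)) * pderiv (cycle_poly (card C))))"
    by (intro sum.cong refl)
  also have "\<dots> = (\<Sum>C\<in>\<C>. of_nat (card C) * (\<Prod>C\<in>\<C>. cycle_poly (card C)) +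
       [:1, 1:] * cycle_poly k * ((\<Prod>D\<in>\<C> - {C}. cycle_poly (card D)) * pderiv (cycle_poly (card C))))"
    using prod.remove[OF assms, of _ "\<lambda>C. cycle_poly (card C)"] by (intro sum.cong refl) simp
  also have "\<dots> = (\<Sum>C\<in>\<C>. of_nat (card C)) * (\<Prod>C\<in>\<C>. cycle_poly (card C)) +
      [:1, 1:] * cycle_poly k * pderiv (\<Prod>C\<in>\<C>. cycle_poly (card C))"
    by (simp only: sum.distrib pderiv_prod sum_distrib_left sum_distrib_right)
  finally show ?thesis by simp
qed

text \<open>With q = 1 + z each summand is q^k + 1 - q^i - q^(k - i). The two geometric sums agree
  under i -> k - i, and the factor z = q - 1 makes them telescope.\<close>

lemma cycle_poly_split_sum:
  assumes "0 < k"
  shows "[:0, 1:] * (\<Sum>i\<in>{1..<k}. cycle_poly i * cycle_poly (k - i))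
    = of_nat (k - 1) * [:0, 1:] * ([:1, 1:] ^ k + 1) - 2 * ([:1, 1:] ^ k - [:1, 1:])"
proof -
  define q :: "real poly" where "q = [:1, 1:]"
  define S where "S = (\<Sum>i\<in>{1..<k}. q ^ i)"
  have z: "[:0, 1:] = q - 1" by (simp add: q_def one_pCons)
  have geo: "(q - 1) * S = q ^ k - q"
    unfolding S_def using assms
  proof (induction k rule: nat_induct_non_zero)
    case (Suc n)
    then have "{1..<Suc n} = insert n {1..<n}" by auto
    with Suc show ?case by (simp add: algebra_simps)
  qed simp
  have rev: "(\<Sum>i\<in>{1..<k}. q ^ (k - i)) = S"
    unfolding S_def by (rule sum.reindex_bij_witness[of _ "\<lambda>i. k - i" "\<lambda>i. k - i"]) auto
  have "(\<Sum>i\<in>{1..<k}. cycle_poly i * cycle_poly (k - i))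
      = (\<Sum>i\<in>{1..<k}. (q ^ k + 1) - q ^ i - q ^ (k - i))"
  proof (intro sum.cong refl)
    fix i assume "i \<in> {1..<k}"
    then have "q ^ k = q ^ i * q ^ (k - i)" by (simp flip: power_add)
    then show "cycle_poly i * cycle_poly (k - i) = (q ^ k + 1) - q ^ i - q ^ (k - i)"
      by (simp add: cycle_poly_def q_def[symmetric] algebra_simps)
  qed
  also have "\<dots> = of_nat (k - 1) * (q ^ k + 1) - 2 * S"
    by (simp only: sum_subtractf rev S_def[symmetric]) simp
  finally have eq: "(\<Sum>i\<in>{1..<k}. cycle_poly i * cycle_poly (k - i))
      = of_nat (k - 1) * (q ^ k + 1) - 2 * S" .
  have "(q - 1) * (\<Sum>i\<in>{1..<k}. cycle_poly i * cycle_poly (k - i))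
      = of_nat (k - 1) * (q - 1) * (q ^ k + 1) - 2 * ((q - 1) * S)"
    unfolding eq by (simp only: algebra_simps)
  then show ?thesis unfolding geo by (simp only: z q_def[symmetric])
qed

text \<open>This is the recurrence for F pulled back to polynomials: the first two terms on the
  right encode multiplication by x, the factor z compensates the change of \<open>n\<close> in the
  binomial index, and \<open>card V\<close> on the left is the ratio of the factorials.\<close>

lemma cycles_poly_recurrence:
  assumes V: "finite V" "p permutes V" and e: "e \<notin> V" and y: "y \<in> V"
  shows "of_nat (card V) * cycles_poly (insert e V) (p \<circ> transpose y e)
    = of_nat (card V + 2) * ([:1, 1:] * cycles_poly V p) - [:0, 1:] * pderiv ([:1, 1:] * cycles_poly V p)
      + [:0, 1:] * (\<Sum>a\<in>V - {y}. cycles_poly V (p \<circ> transpose a y))"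
proof -
  define q z :: "real poly" where "q = [:1, 1:]" and "z = [:0, 1:]"
  define k where "k = card (orbit p y)"
  define \<C> where "\<C> = cycles V p - {orbit p y}"
  define R where "R = (\<Prod>C\<in>\<C>. cycle_poly (card C))"
  have "0 < k" unfolding k_def by (rule orbit_period(1)[OF V])
  have mem: "orbit p y \<in> cycles V p" using y by (simp add: cycles_def)
  have fin: "finite \<C>" using V(1) by (simp add: \<C>_def)
  have "card V = k + (\<Sum>C\<in>\<C>. card C)"
    unfolding sum_card_cycles[OF V, symmetric] k_def \<C>_def using V(1) mem by (intro sum.remove) auto
  then obtain M where M: "card V = k + M" "(\<Sum>C\<in>\<C>. card C) = M" by blast
  obtain k' where k': "k = Suc k'" using \<open>0 < k\<close> by (cases k) auto
  have z: "z = q - 1" by (simp add: q_def z_def one_pCons)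
  have pq: "pderiv q = 1" by (simp add: q_def pderiv_pCons)
  have deriv: "q * pderiv (cycle_poly k) = of_nat k * q ^ k"
    using pderiv_cycle_poly[of k] by (simp only: q_def)
  have "z * (\<Sum>i\<in>{1..<k}. cycle_poly i * cycle_poly (k - i))
    = of_nat k' * z * (q ^ k + 1) - 2 * (q ^ k - q)"
    unfolding q_def z_def cycle_poly_split_sum[OF \<open>0 < k\<close>] by (simp only: k' diff_Suc_1)
  then have sum: "z * (\<Sum>a\<in>V - {y}. cycles_poly V (p \<circ> transpose a y))
    = (of_nat k' * z * (q ^ k + 1) - 2 * (q ^ k - q)) * R + z * (of_nat M * R + q * cycle_poly k * pderiv R)"
    unfolding sum_cycles_poly_transpose[OF V y] k_def[symmetric] \<C>_def[symmetric] R_def[symmetric]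
      cycle_poly_join_sum[OF fin] M(2) q_def[symmetric] distrib_left
    by (simp only: mult.assoc[symmetric])
  have pd: "pderiv (q * (cycle_poly k * R))
    = cycle_poly k * R + (q * pderiv (cycle_poly k)) * R + q * cycle_poly k * pderiv R"
    by (simp add: pderiv_mult pq algebra_simps)
  show ?thesis
    unfolding cycles_poly_insert_moved[OF V e y] cycles_poly_remove[OF V(1) y, of p]
      k_def[symmetric] \<C>_def[symmetric] R_def[symmetric] q_def[symmetric] z_def[symmetric] sum pd deriv
    \<comment> \<open>The terms with \<open>pderiv R\<close> cancel between the derivative and the
      join sum; what remains is \<open>R\<close> times an identity in q, \<open>k'\<close> and
      \<open>M\<close>.\<close>
    unfolding M(1) k' z
    by (simp add: cycle_poly_def q_def[symmetric] algebra_simps)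
qed

section \<open>Evaluation of the generating function\<close>

lemma card_full_cycles:
  assumes "finite V" "V \<noteq> {}"
  shows "card (full_cycles V) = fact (card V - 1)"
  using assms
proof (induction rule: finite_ne_induct)
  case (singleton v)
  have "full_cycles {v} = {id}" by (auto simp: full_cycles_def cycles_def)
  then show ?case by simp
next
  case (insert e V)
  have "card (full_cycles (insert e V)) = card V * card (full_cycles V)"
    using bij_betw_same_card[OF full_cycles_insert[of V e]] insert.hyps by (simp add: card_cartesian_product)
  moreover have "card V > 0" using insert.hyps by (simp add: card_gt_0_iff)
  ultimately show ?case using insert.IH insert.hyps fact_reduce[where 'a = nat, of "card V"] by simp
qed

text \<open>The linear map z^k -> \<open>x gchoose (n + 1 - k)\<close> on polynomials of degree at
  most \<open>n\<close>; higher coefficients are discarded.\<close>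

definition gbinomial_transform :: "nat \<Rightarrow> real poly \<Rightarrow> real \<Rightarrow> real" where
  "gbinomial_transform n p x = (\<Sum>k\<le>n. coeff p k * (x gchoose (n + 1 - k)))"

lemma gbinomial_transform_add:
  "gbinomial_transform n (p + q) x = gbinomial_transform n p x + gbinomial_transform n q x"
  by (simp add: gbinomial_transform_def sum.distrib algebra_simps)

lemma gbinomial_transform_sum:
  "gbinomial_transform n (\<Sum>i\<in>I. p i) x = (\<Sum>i\<in>I. gbinomial_transform n (p i) x)"
  unfolding gbinomial_transform_def coeff_sum sum_distrib_right by (rule sum.swap)

lemma gbinomial_transform_of_nat:
  "gbinomial_transform n (of_nat c * p) x = c * gbinomial_transform n p x"
  by (simp add: gbinomial_transform_def of_nat_poly sum_distrib_left algebra_simps)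

lemma gbinomial_transform_shift:
  "gbinomial_transform (Suc n) ([:0, 1:] * p) x = gbinomial_transform n p x"
  unfolding gbinomial_transform_def by (subst sum.atMost_Suc_shift) simp

text \<open>With j = n + 1 - k, \<open>x * (x gchoose j)\<close> equals
  \<open>j * (x gchoose j) + (j + 1) * (x gchoose (j + 1))\<close>. At level \<open>Suc n\<close>
  these binomials belong to z^(k + 1) and z^k, and each weight is n + 2 minus the exponent, which is
  the operator (n + 2) - z d/dz applied to (1 + z) p.\<close>

lemma gbinomial_transform_times:
  assumes "degree p \<le> n"
  shows "x * gbinomial_transform n p x
    = gbinomial_transform (Suc n) (of_nat (n + 2) * ([:1, 1:] * p) - [:0, 1:] * pderiv ([:1, 1:] * p)) x"
proof -
  define W where "W = of_nat (n + 2) * ([:1, 1:] * p) - [:0, 1:] * pderiv ([:1, 1:] * p)"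
  define G where "G j = x gchoose j" for j
  have W0: "coeff W 0 = real (n + 2) * coeff p 0" by (simp add: W_def of_nat_poly)
  have W_Suc: "coeff W (Suc k) = (real n + 1 - real k) * (coeff p (Suc k) + coeff p k)" for k
    by (simp add: W_def of_nat_poly coeff_pderiv algebra_simps)
  have "gbinomial_transform (Suc n) W x
    = real (n + 2) * coeff p 0 * G (n + 2)
      + (\<Sum>k\<le>n. (real n + 1 - real k) * (coeff p (Suc k) + coeff p k) * G (n + 1 - k))"
    unfolding gbinomial_transform_def sum.atMost_Suc_shift G_def W0 W_Suc by simp
  also have "\<dots> = (real (n + 2) * coeff p 0 * G (n + 2)
      + (\<Sum>k\<le>n. (real n + 1 - real k) * coeff p (Suc k) * G (n + 1 - k)))
      + (\<Sum>k\<le>n. (real n + 1 - real k) * coeff p k * G (n + 1 - k))"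
    by (simp add: sum.distrib distrib_left distrib_right)
  also have "real (n + 2) * coeff p 0 * G (n + 2)
      + (\<Sum>k\<le>n. (real n + 1 - real k) * coeff p (Suc k) * G (n + 1 - k))
      = (\<Sum>k\<le>Suc n. (real n + 2 - real k) * coeff p k * G (n + 2 - k))"
    unfolding sum.atMost_Suc_shift by (simp add: algebra_simps)
  \<comment> \<open>The top term \<open>k = n + 1\<close> has weight 1 and vanishes by the degree
    bound.\<close>
  also have "\<dots> = (\<Sum>k\<le>n. (real n + 2 - real k) * coeff p k * G (n + 2 - k))"
    using coeff_eq_0[of p "Suc n"] assms by simp
  also have "\<dots> + (\<Sum>k\<le>n. (real n + 1 - real k) * coeff p k * G (n + 1 - k))
    = (\<Sum>k\<le>n. coeff p k * (x * G (n + 1 - k)))"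
    unfolding sum.distrib[symmetric]
  proof (rule sum.cong[OF refl])
    fix k assume "k \<in> {..n}"
    then have "n + 2 - k = Suc (n + 1 - k)" "real (n + 1 - k) = real n + 1 - real k" by auto
    then show "(real n + 2 - real k) * coeff p k * G (n + 2 - k)
      + (real n + 1 - real k) * coeff p k * G (n + 1 - k) = coeff p k * (x * G (n + 1 - k))"
      unfolding G_def gbinomial_mult_1[of x "n + 1 - k"] by (simp add: algebra_simps)
  qed
  finally show ?thesis
    by (simp add: W_def gbinomial_transform_def G_def sum_distrib_left mult_ac)
qed

text \<open>The induction inserts a point and keeps \<open>s\<close> arbitrary, since the recurrence
  for a moved point involves all \<open>s' \<circ> transpose a y\<close> on the smaller set.\<close>

lemma cycle_gf_eq:
  assumes "finite V" "V \<noteq> {}" "s permutes V"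
  shows "cycle_gf V s x = fact (card V - 1) * gbinomial_transform (card V) (cycles_poly V s) x"
  using assms
proof (induction arbitrary: s rule: finite_ne_induct)
  case (singleton v)
  then have s: "s = id" by simp
  have "full_cycles {v} = {id}" by (auto simp: full_cycles_def cycles_def)
  moreover have "cycles {v} id = {{v}}" using orbit_eq_singleton_iff[of id v] by (simp add: cycles_def)
  moreover from this have "cycles {v} (\<lambda>a. a) = {{v}}" by (simp add: id_def)
  ultimately show ?case
    by (simp add: s cycle_gf_def cycles_poly_def gbinomial_transform_def)
next
  case (insert e V)
  have card: "card (insert e V) = Suc (card V)" "card V \<noteq> 0" using insert.hyps by simp_all
  have fact: "fact (card V) = real (card V) * fact (card V - 1)"
    using card(2) fact_reduce[of "card V"] by simp
  show ?case
  proof (cases "s e = e")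
    case True
    have s: "s permutes V"
      by (rule permutes_superset[OF insert.prems]) (use True in auto)
    show ?thesis
      unfolding cycle_gf_insert_fixed[OF insert.hyps(1,2,3) s] insert.IH[OF s]
        cycles_poly_insert_fixed[OF insert.hyps(1) s insert.hyps(3)] card gbinomial_transform_shift
      by (simp add: fact)
  next
    case False
    define y where "y = inv s e"
    have sy: "s y = e" unfolding y_def by (rule permutes_inverses[OF insert.prems])
    have y: "y \<in> V" using False sy permutes_in_image[OF insert.prems, of y] by auto
    define s' where "s' = s \<circ> transpose y e"
    have s_eq: "s = s' \<circ> transpose y e" by (simp add: s'_def comp_assoc)
    have "s' permutes insert e V"
      unfolding s'_def using y by (intro permutes_compose insert.prems permutes_swap_id) auto
    then have s': "s' permutes V"
      by (rule permutes_superset) (auto simp: s'_def sy)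
    have IH: "cycle_gf V (s' \<circ> transpose a y) x
      = fact (card V - 1) * gbinomial_transform (card V) (cycles_poly V (s' \<circ> transpose a y)) x"
      if "a \<in> V" for a
      by (intro insert.IH permutes_compose s' permutes_swap_id that y)
    have "cycle_gf (insert e V) s x = fact (card V - 1) *
      (x * gbinomial_transform (card V) (cycles_poly V s') x
       + gbinomial_transform (card V) (\<Sum>a\<in>V - {y}. cycles_poly V (s' \<circ> transpose a y)) x)"
      unfolding s_eq cycle_gf_insert_moved[OF insert.hyps(1,3) s' y] insert.IH[OF s']
      by (simp add: IH gbinomial_transform_sum sum_distrib_left algebra_simps)
    also have "\<dots> = fact (card V - 1) * gbinomial_transform (Suc (card V))
        (of_nat (card V) * cycles_poly (insert e V) s) x"
      unfolding s_eq cycles_poly_recurrence[OF insert.hyps(1) s' insert.hyps(3) y]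
        gbinomial_transform_add gbinomial_transform_shift
        gbinomial_transform_times[OF degree_cycles_poly[OF insert.hyps(1) s']] ..
    finally show ?thesis unfolding card gbinomial_transform_of_nat by (simp add: fact)
  qed
qed

section \<open>From full cycles to a conjugacy class\<close>

lemma perm_cycles_eq_cycles: "perm_cycles n = cycles {1..n}"
  by (simp add: fun_eq_iff perm_cycles_def cycles_def)

lemma full_cycle_conj_long_cycle:
  assumes w: "w \<in> full_cycles {1..n}"
  obtains t where "t permutes {1..n}" "w \<circ> t = t \<circ> long_cycle n"
proof -
  have perm: "w permutes {1..n}" and one: "card (cycles {1..n} w) = 1"
    using w by (auto simp: full_cycles_def)
  then have n: "1 \<in> {1..n}" by (cases n) (auto simp: cycles_def)
  obtain C where "cycles {1..n} w = {C}" using one by (auto simp: card_1_singleton_iff)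
  moreover have "orbit w 1 \<in> cycles {1..n} w" using n by (simp add: cycles_def)
  ultimately have orb: "orbit w 1 = {1..n}" using Union_cycles[OF _ perm] by auto
  note per = orbit_period[OF finite_atLeastAtMost perm, of 1, unfolded orb, simplified]
  \<comment> \<open>\<open>t\<close> numbers the points along \<open>w\<close> so that
    \<open>t n = 1\<close>; the wrap-around of the long cycle from \<open>n\<close> to 1 then
    matches the step from 1 to \<open>w 1 = t 1\<close>.\<close>
  define t where "t i = (if i \<in> {1..n} then (w ^^ i) 1 else i)" for i
  have "{1..n} = (\<lambda>j. (w ^^ Suc j) 1) ` {0..<n}"
    using orbit_eq_image_Suc[OF per(2,1)] orb by simp
  also have "\<dots> = (\<lambda>i. (w ^^ i) 1) ` Suc ` {0..<n}" by (simp only: image_image)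
  also have "Suc ` {0..<n} = {1..n}" by (simp add: image_Suc_atLeastLessThan atLeastLessThanSuc_atLeastAtMost)
  also have "(\<lambda>i. (w ^^ i) 1) ` {1..n} = t ` {1..n}" by (simp add: t_def)
  finally have "t ` {1..n} = {1..n}" ..
  then have "bij_betw t {1..n} {1..n}"
    by (simp add: bij_betw_def eq_card_imp_inj_on)
  then have t: "t permutes {1..n}" by (rule bij_imp_permutes) (auto simp: t_def)
  have "w (t i) = t (long_cycle n i)" for i
    using permutes_not_in[OF perm, of i] per(2) n by (cases "i = n") (auto simp: t_def long_cycle_def)
  then show ?thesis using that[OF t] by (simp add: fun_eq_iff)
qed

lemma conj_class_conj:
  assumes "s \<in> conj_class n \<gamma>" "t permutes {1..n}"
  shows "t \<circ> s \<circ> inv t \<in> conj_class n \<gamma>"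
proof -
  have s: "s permutes {1..n}" using assms(1) by (simp add: conj_class_def)
  have si: "s \<circ> inv t permutes {1..n}"
    using s permutes_inv[OF assms(2)] by (intro permutes_compose)
  have inj: "inj ((`) t)" using permutes_inj[OF assms(2)] by (simp add: inj_image_eq_iff inj_def)
  have "perm_cycles n (t \<circ> s \<circ> inv t) = (`) t ` perm_cycles n s"
    using cycles_comp_commute[OF _ si assms(2)] permutes_inv_o(2)[OF assms(2)]
    by (simp add: perm_cycles_eq_cycles comp_assoc)
  then have "cycle_type n (t \<circ> s \<circ> inv t) = image_mset (\<lambda>C. card (t ` C)) (mset_set (perm_cycles n s))"
    unfolding cycle_type_def
    by (simp add: image_mset_mset_set[symmetric] inj_on_subset[OF inj] multiset.map_comp comp_def)
  also have "\<dots> = cycle_type n s"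
    unfolding cycle_type_def using permutes_inj[OF assms(2)] by (simp add: card_image inj_on_subset)
  finally show ?thesis
    using assms si by (auto simp: conj_class_def comp_assoc intro: permutes_compose)
qed

lemma finite_conj_class [simp]: "finite (conj_class n \<gamma>)"
  unfolding conj_class_def using finite_permutations[of "{1..n}"] by (auto intro: rev_finite_subset)

text \<open>If \<open>t\<close> conjugates the long cycle into \<open>w\<close>, conjugating
  \<open>s\<close> by \<open>inv t\<close> permutes the class and turns
  \<open>inv s \<circ> w\<close> into a conjugate product with the long cycle.\<close>

lemma sum_conj_class_full_cycle:
  assumes w: "w \<in> full_cycles {1..n}"
  shows "(\<Sum>s\<in>conj_class n \<gamma>. f (card (cycles {1..n} (inv s \<circ> w))))
    = (\<Sum>s\<in>conj_class n \<gamma>. f (card (cycles {1..n} (inv s \<circ> long_cycle n))))"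
proof -
  obtain t where t: "t permutes {1..n}" and wt: "w \<circ> t = t \<circ> long_cycle n"
    by (rule full_cycle_conj_long_cycle[OF w])
  note ti = permutes_inv[OF t] and to = permutes_inv_o[OF t]
  have to': "t \<circ> (inv t \<circ> f) = f" "inv t \<circ> (t \<circ> f) = f" for f :: "nat \<Rightarrow> nat"
    using to by (simp_all add: comp_assoc[symmetric])
  have long: "long_cycle n = inv t \<circ> w \<circ> t" using wt to' by (simp add: comp_assoc)
  have "w permutes {1..n}" using w by (simp add: full_cycles_def)
  then have long_perm: "long_cycle n permutes {1..n}"
    unfolding long using t ti by (intro permutes_compose)
  show ?thesis
  proof (rule sum.reindex_bij_witness[of _ "\<lambda>s. t \<circ> s \<circ> inv t" "\<lambda>s. inv t \<circ> s \<circ> t"])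
    fix s assume s: "s \<in> conj_class n \<gamma>"
    show "t \<circ> s \<circ> inv t \<in> conj_class n \<gamma>" by (rule conj_class_conj[OF s t])
    show "inv t \<circ> s \<circ> t \<in> conj_class n \<gamma>"
      using conj_class_conj[OF s ti] permutes_inv_inv[OF t] by simp
    show "t \<circ> (inv t \<circ> s \<circ> t) \<circ> inv t = s" "inv t \<circ> (t \<circ> s \<circ> inv t) \<circ> t = s"
      using to by (simp_all add: comp_assoc to')
    have sp: "s permutes {1..n}" using s by (simp add: conj_class_def)
    have "inv (inv t \<circ> s \<circ> t) = inv t \<circ> inv s \<circ> t"
      using to permutes_inv_o[OF sp] permutes_inv_o(1)[OF sp]
      by (intro inv_unique_comp) (simp_all add: comp_assoc to' fun_eq_iff permutes_inverses[OF sp] permutes_inverses[OF t])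
    then have "inv (inv t \<circ> s \<circ> t) \<circ> long_cycle n = inv t \<circ> (inv s \<circ> w \<circ> t)"
      unfolding long by (simp add: comp_assoc to')
    moreover have "inv s \<circ> w \<circ> t permutes {1..n}"
      using sp t w by (intro permutes_compose permutes_inv) (auto simp: full_cycles_def)
    then have "card (cycles {1..n} (inv t \<circ> (inv s \<circ> w \<circ> t))) = card (cycles {1..n} (inv s \<circ> w \<circ> t \<circ> inv t))"
      using ti by (intro card_cycles_comp_commute) auto
    moreover have "inv s \<circ> w \<circ> t \<circ> inv t = inv s \<circ> w" using to by (simp add: comp_assoc)
    ultimately show "f (card (cycles {1..n} (inv (inv t \<circ> s \<circ> t) \<circ> long_cycle n)))
        = f (card (cycles {1..n} (inv s \<circ> w)))"
      by simp
  qed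
qed

text \<open>Positivity matters: \<open>long_cycle 0\<close> sends 0 to 1.\<close>

lemma long_cycle_permutes:
  assumes "0 < n"
  shows "long_cycle n permutes {1..n}"
proof (rule bij_imp_permutes)
  have "inj_on (long_cycle n) {1..n}"
    by (rule inj_onI) (auto simp: long_cycle_def split: if_splits)
  moreover have "long_cycle n ` {1..n} \<subseteq> {1..n}"
    using assms by (auto simp: long_cycle_def)
  ultimately show "bij_betw (long_cycle n) {1..n} {1..n}"
    by (simp add: bij_betw_def endo_inj_surj)
qed (use assms in \<open>auto simp: long_cycle_def\<close>)

lemma cycles_poly_conj_class:
  assumes "s \<in> conj_class n \<gamma>"
  shows "cycles_poly {1..n} s = prod_list (map cycle_poly \<gamma>)"
proof -
  have "cycles_poly {1..n} s = prod_mset (image_mset cycle_poly (cycle_type n s))"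
    unfolding cycles_poly_def cycle_type_def perm_cycles_eq_cycles
    by (simp add: prod_unfold_prod_mset multiset.map_comp comp_def)
  also have "cycle_type n s = mset \<gamma>" using assms by (simp add: conj_class_def)
  finally show ?thesis by (metis mset_map prod_mset_prod_list)
qed

text \<open>Double counting of pairs \<open>(s, w)\<close>: each of the \<open>fact (n - 1)\<close>
  full cycles contributes as much as the long cycle, while each \<open>s\<close> contributes a value
  depending only on \<gamma>. The factorial cancels.\<close>

lemma sum_conj_class_long_cycle:
  assumes "0 < n"
  shows "(\<Sum>s\<in>conj_class n \<gamma>. x ^ card (cycles {1..n} (inv s \<circ> long_cycle n)))
    = card (conj_class n \<gamma>) * gbinomial_transform n (prod_list (map cycle_poly \<gamma>)) x"
    (is "?lhs = ?rhs")
proof -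
  have "fact (n - 1) * ?lhs
    = (\<Sum>w\<in>full_cycles {1..n}. \<Sum>s\<in>conj_class n \<gamma>. x ^ card (cycles {1..n} (inv s \<circ> w)))"
    using sum_conj_class_full_cycle[where f = "\<lambda>k. x ^ k"] card_full_cycles[of "{1..n}"] assms by simp
  also have "\<dots> = (\<Sum>s\<in>conj_class n \<gamma>. cycle_gf {1..n} s x)"
    unfolding cycle_gf_def by (rule sum.swap)
  also have "\<dots> = (\<Sum>s\<in>conj_class n \<gamma>. fact (n - 1) * gbinomial_transform n (prod_list (map cycle_poly \<gamma>)) x)"
  proof (rule sum.cong[OF refl])
    fix s assume s: "s \<in> conj_class n \<gamma>"
    then have "s permutes {1..n}" by (simp add: conj_class_def)
    then show "cycle_gf {1..n} s x = fact (n - 1) * gbinomial_transform n (prod_list (map cycle_poly \<gamma>)) x"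
      using cycle_gf_eq[of "{1..n}" s x] cycles_poly_conj_class[OF s] assms by simp
  qed
  finally have "fact (n - 1) * ?lhs = fact (n - 1) * ?rhs" by simp
  then show ?thesis by simp
qed

section \<open>Coefficient extraction: Stirling numbers and compositions\<close>

lemma mu_eq_card:
  assumes "0 < n"
  shows "mu n m \<gamma> = card {s \<in> conj_class n \<gamma>. card (cycles {1..n} (inv s \<circ> long_cycle n)) = m}"
  unfolding mu_def
proof (rule bij_betw_same_card[of fst], rule bij_betw_byWitness[of _ "\<lambda>s. (s, inv s \<circ> long_cycle n)"])
  have inv_eq: "inv s \<circ> long_cycle n = p" if "s permutes {1..n}" "s \<circ> p = long_cycle n" for s p
    using that(2)[symmetric] permutes_inv_o(2)[OF that(1)] by (simp add: comp_assoc[symmetric])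
  have comp_eq: "s \<circ> (inv s \<circ> long_cycle n) = long_cycle n" if "s permutes {1..n}" for s
    using permutes_inv_o(1)[OF that] by (simp add: comp_assoc[symmetric])
  let ?A = "{(s, p). s permutes {1..n} \<and> p permutes {1..n} \<and> s \<circ> p = long_cycle n \<and>
    cycle_type n s = mset \<gamma> \<and> num_cycles n p = m}"
  let ?B = "{s \<in> conj_class n \<gamma>. card (cycles {1..n} (inv s \<circ> long_cycle n)) = m}"
  show "\<forall>a\<in>?A. (fst a, inv (fst a) \<circ> long_cycle n) = a" using inv_eq by auto
  show "\<forall>s\<in>?B. fst (s, inv s \<circ> long_cycle n) = s" by simp
  show "fst ` ?A \<subseteq> ?B"
    using inv_eq by (auto simp: conj_class_def num_cycles_def perm_cycles_eq_cycles)
  show "(\<lambda>s. (s, inv s \<circ> long_cycle n)) ` ?B \<subseteq> ?A"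
    using comp_eq long_cycle_permutes[OF assms]
    by (auto simp: conj_class_def num_cycles_def perm_cycles_eq_cycles intro: permutes_compose permutes_inv)
qed

text \<open>The falling factorial is a rising factorial in \<open>- x\<close> up to sign, and that
  one expands in unsigned Stirling numbers. Padding with the zeros \<open>stirling k m\<close> for
  \<open>m > k\<close> gives all \<open>k\<close> a common range.\<close>

lemma gbinomial_stirling:
  fixes x :: real
  assumes "k \<le> n"
  shows "x gchoose k = (\<Sum>m\<le>n. (-1) ^ (k + m) * stirling k m / fact k * x ^ m)"
proof -
  have "x gchoose k = (-1) ^ k / fact k * (\<Sum>m\<le>k. stirling k m * (- x) ^ m)"
    unfolding gbinomial_pochhammer stirling_pochhammer[symmetric] by simp
  also have "\<dots> = (\<Sum>m\<le>k. (-1) ^ (k + m) * stirling k m / fact k * x ^ m)"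
    unfolding sum_distrib_left by (intro sum.cong refl) (simp add: power_add power_minus[of x])
  also have "\<dots> = (\<Sum>m\<le>n. (-1) ^ (k + m) * stirling k m / fact k * x ^ m)"
    using assms by (intro sum.mono_neutral_left) auto
  finally show ?thesis .
qed

text \<open>Both sides are coefficients of polynomial functions that agree at every real
  \<open>x\<close>. The exponents run to \<open>n + 1\<close> because
  \<open>x gchoose (n + 1)\<close> occurs for \<open>k = 0\<close>.\<close>

lemma mu_eq_sum_coeff:
  assumes "0 < n" "m \<le> n"
  shows "real (mu n m \<gamma>) = card (conj_class n \<gamma>) *
    (\<Sum>k\<le>n. coeff (prod_list (map cycle_poly \<gamma>)) k *
      ((-1) ^ (n + 1 - k + m) * stirling (n + 1 - k) m / fact (n + 1 - k)))"
proof -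
  define c where "c s = card (cycles {1..n} (inv s \<circ> long_cycle n))" for s
  define A where "A = coeff (prod_list (map cycle_poly \<gamma>))"
  have c_le: "c s \<le> n" for s
    unfolding c_def cycles_def using card_image_le[of "{1..n}"] by fastforce
  have "(\<Sum>m\<le>n + 1. real (mu n m \<gamma>) * x ^ m) = (\<Sum>m\<le>n + 1. (card (conj_class n \<gamma>) *
      (\<Sum>k\<le>n. A k * ((-1) ^ (n + 1 - k + m) * stirling (n + 1 - k) m / fact (n + 1 - k)))) * x ^ m)" for x
  proof -
    have "(\<Sum>m\<le>n + 1. real (mu n m \<gamma>) * x ^ m) = (\<Sum>m\<le>n + 1. \<Sum>s | s \<in> conj_class n \<gamma> \<and> c s = m. x ^ c s)"
      by (simp add: mu_eq_card[OF assms(1)] c_def)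
    \<comment> \<open>The class is regrouped by the number of cycles, which is at most
      \<open>n\<close>.\<close>
    also have "\<dots> = (\<Sum>s\<in>conj_class n \<gamma>. x ^ c s)"
      using c_le by (intro sum.group) (auto simp: le_SucI)
    also have "\<dots> = card (conj_class n \<gamma>) * (\<Sum>k\<le>n. A k * (x gchoose (n + 1 - k)))"
      unfolding c_def sum_conj_class_long_cycle[OF assms(1)] gbinomial_transform_def A_def ..
    also have "(\<Sum>k\<le>n. A k * (x gchoose (n + 1 - k))) = (\<Sum>k\<le>n. \<Sum>m\<le>n + 1.
        A k * ((-1) ^ (n + 1 - k + m) * stirling (n + 1 - k) m / fact (n + 1 - k)) * x ^ m)"
      unfolding gbinomial_stirling[OF diff_le_self] sum_distrib_left by (simp only: mult.assoc)
    also have "\<dots> = (\<Sum>m\<le>n + 1. \<Sum>k\<le>n.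
        A k * ((-1) ^ (n + 1 - k + m) * stirling (n + 1 - k) m / fact (n + 1 - k)) * x ^ m)"
      by (rule sum.swap)
    finally show ?thesis by (simp only: sum_distrib_left sum_distrib_right mult.assoc)
  qed
  then have "\<forall>m\<le>n + 1. real (mu n m \<gamma>) = card (conj_class n \<gamma>) *
      (\<Sum>k\<le>n. A k * ((-1) ^ (n + 1 - k + m) * stirling (n + 1 - k) m / fact (n + 1 - k)))"
    unfolding polyfun_eq_coeffs[symmetric] by blast
  then show ?thesis using assms(2) by (simp add: A_def)
qed

lemma coeff_cycle_poly: "coeff (cycle_poly g) i = (if i = 0 then 0 else real (g choose i))"
proof (cases "i \<le> g")
  case True
  then show ?thesis by (simp add: cycle_poly_def coeff_linear_poly_power coeff_1)
next
  case False
  then show ?thesis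
    using degree_cycle_poly[of g] by (simp add: coeff_eq_0)
qed

lemma finite_compositions: "finite (compositions d N)"
proof (rule finite_subset)
  show "compositions d N \<subseteq> {ks. set ks \<subseteq> {..N} \<and> length ks = d}"
    by (auto simp: compositions_def member_le_sum_list)
qed (simp add: finite_lists_length_eq)

lemma compositions_Suc:
  "compositions (Suc d) N = (\<lambda>(i, ks). i # ks) ` (SIGMA i:{1..N}. compositions d (N - i))"
  (is "?L = ?R")
proof
  show "?L \<subseteq> ?R"
  proof
    fix ks assume "ks \<in> ?L"
    then obtain i js where "ks = i # js" "length js = d" "0 < i" "\<forall>x\<in>set js. 0 < x" "i + sum_list js = N"
      by (auto simp: compositions_def length_Suc_conv)
    then show "ks \<in> ?R" by (auto simp: compositions_def image_iff)
  qed
qed (auto simp: compositions_def)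

lemma coeff_prod_cycle_poly:
  "coeff (prod_list (map cycle_poly \<gamma>)) N
    = (\<Sum>ks\<in>compositions (length \<gamma>) N. real (\<Prod>i<length \<gamma>. (\<gamma> ! i) choose (ks ! i)))"
proof (induction \<gamma> arbitrary: N)
  case Nil
  have "compositions 0 N = (if N = 0 then {[]} else {})" by (auto simp: compositions_def)
  then show ?case by (simp add: coeff_1)
next
  case (Cons g \<gamma>)
  let ?f = "\<lambda>ks. real (\<Prod>i<length \<gamma>. (\<gamma> ! i) choose (ks ! i))"
  have "coeff (prod_list (map cycle_poly (g # \<gamma>))) N
    = (\<Sum>i\<le>N. coeff (cycle_poly g) i * (\<Sum>ks\<in>compositions (length \<gamma>) (N - i). ?f ks))"
    by (simp add: coeff_mult Cons.IH)
  \<comment> \<open>The vanishing constant term removes \<open>i = 0\<close>, so the first part is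
    positive.\<close>
  also have "\<dots> = (\<Sum>i\<in>{1..N}. real (g choose i) * (\<Sum>ks\<in>compositions (length \<gamma>) (N - i). ?f ks))"
    by (intro sum.mono_neutral_cong_right) (auto simp: coeff_cycle_poly)
  also have "\<dots> = (\<Sum>(i, ks)\<in>(SIGMA i:{1..N}. compositions (length \<gamma>) (N - i)). real (g choose i) * ?f ks)"
    by (simp add: sum_distrib_left sum.Sigma finite_compositions)
  also have "\<dots> = (\<Sum>ks\<in>compositions (Suc (length \<gamma>)) N.
      real (\<Prod>i<Suc (length \<gamma>). ((g # \<gamma>) ! i) choose (ks ! i)))"
    unfolding compositions_Suc
    by (subst sum.reindex) (auto simp: inj_on_def prod.lessThan_Suc_shift simp del: prod.lessThan_Suc intro!: sum.cong)
  finally show ?case by simp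
qed

theorem theorem4p3:
  fixes n m :: nat and \<gamma> :: "nat list"
  assumes "is_partition \<gamma> n" and "1 \<le> m" and "m \<le> n"
  shows "real (mu n m \<gamma>) =
    real (card (conj_class n \<gamma>)) *
    (\<Sum>k = 0..n - m. ((-1) ^ k * real (stirling (m + k) m) / fact (m + k)) *
       (\<Sum>ks\<in>compositions (length \<gamma>) (n - m - k + 1).
          real (\<Prod>i<length \<gamma>. (\<gamma> ! i) choose (ks ! i))))"
proof -
  define A where "A = coeff (prod_list (map cycle_poly \<gamma>))"
  define f where "f N = (-1) ^ (N + m) * real (stirling N m) / fact N" for N
  have "\<gamma> \<noteq> []" using assms by (auto simp: is_partition_def)
  \<comment> \<open>At least one factor is present, and each factor has constant term 0.\<close>
  then have A0: "A 0 = 0"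
    by (cases \<gamma>) (simp_all add: A_def coeff_mult coeff_cycle_poly)
  \<comment> \<open>For \<open>k > n - m + 1\<close> the Stirling number in
    \<open>f (n + 1 - k)\<close> has lower index \<open>m\<close> above its upper index, hence is
    0.\<close>
  have "(\<Sum>k\<le>n. A k * f (n + 1 - k)) = (\<Sum>k\<in>{1..n - m + 1}. A k * f (n + 1 - k))"
    using assms A0 by (intro sum.mono_neutral_right) (auto simp: f_def not_le)
  \<comment> \<open>Reversal of the range: the new \<open>k\<close> is the excess of the Stirling
    index \<open>n + 1 - k\<close> over \<open>m\<close>.\<close>
  also have "\<dots> = (\<Sum>k = 0..n - m. f (m + k) * A (n - m - k + 1))"
    using assms by (intro sum.reindex_bij_witness[of _ "\<lambda>k. n - m - k + 1" "\<lambda>k. n - m + 1 - k"]) auto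
  also have "\<dots> = (\<Sum>k = 0..n - m. ((-1) ^ k * real (stirling (m + k) m) / fact (m + k)) * A (n - m - k + 1))"
  proof (rule sum.cong[OF refl])
    fix k
    have "(-1 :: real) ^ (m + k + m) = (-1) ^ (2 * m + k)" by (simp add: mult_2 add_ac)
    then show "f (m + k) * A (n - m - k + 1)
      = ((-1) ^ k * real (stirling (m + k) m) / fact (m + k)) * A (n - m - k + 1)"
      by (simp add: f_def power_add power_mult)
  qed
  finally show ?thesis
    using mu_eq_sum_coeff[of n m \<gamma>] assms
    unfolding A_def f_def coeff_prod_cycle_poly by simp
qed

end
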